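(* (i) Let $C$ be an arc in $\mathbb{K}^2$ with pure endpoints. Then $\Gamma^{-1}(C)$ is an 8-path in $\mathbb{Z}^2$ if and only if $\Gamma^{*}(\Gamma^{-1}(C))=C$. (ii) Let $J\subseteq\mathbb{K}^2$ be a Jordan curve in $\mathbb{K}^2$. Then $\Gamma^{-1}(J)$ is a closed 8-curve if and only if $\Gamma^{*}(\Gamma^{-1}(J))=J$.
   Context: Points $(x,y)\neq(x',y')$ of $\mathbb{Z}^2$ are 8-adjacent if $|x-x'|\le 1$ and $|y-y'|\le 1$. A subset $S\subseteq\mathbb{Z}^2$ is 8-connected if it cannot be partitioned into two nonempty subsets $P,Q$ such that no point of $P$ is 8-adjacent to a point of $Q$. An 8-path is a set $\{x_0,x_1,\dots,x_n\}\subseteq\mathbb{Z}^2$ of $n+1$ distinct points, $n\ge 1$, such that for $i<j\le n$, $x_i$ and $x_j$ are 8-adjacent if and only if $j=i+1$. A closed 8-curve is a finite 8-connected set $C\subseteq\mathbb{Z}^2$ with at least four points such that every point of $C$ is 8-adjacent to exactly two points of $C$. $\mathbb{K}$ is $\mathbb{Z}$ with the Khalimsky topology, generated by the sets $N(n)=\{n\}$ for $n$ odd and $N(n)=\{n-1,n,n+1\}$ for $n$ even; $\mathbb{K}^2$ has the product topology. For $x\in\mathbb{K}^2$, $N(x)$ is the smallest open set containing $x$, $cl(x)$ is the closure of $\{x\}$, and $A(x)=\{y\neq x:\{x,y\}\text{ is connected}\}$. A point of $\mathbb{K}^2$ is pure if its coordinates are both even or both odd, and mixed otherwise. An arc in $\mathbb{K}^2$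 is a subset which, with the subspace topology, is homeomorphic to a finite interval of $\mathbb{K}$ with at least two points; the endpoints of an arc $C$ are its two points $x$ with $|A(x)\cap C|=1$. A Jordan curve in $\mathbb{K}^2$ is a connected subset $J$ with $|J|\ge 4$ such that $J\setminus\{x\}$ is an arc for every $x\in J$. $\Gamma:\mathbb{Z}^2\to\mathbb{K}^2$ is $\Gamma(x,y)=(x+y,y-x)$. For $A\subseteq\mathbb{Z}^2$, $$\Gamma^*(A)=\Gamma(A)\cup\{x\in\mathbb{K}^2: x\text{ is mixed and } N(x)\subseteq\Gamma(A)\cup\{x\}\text{ or } cl(x)\subseteq\Gamma(A)\cup\{x\}\}.$$ *)

theory Defs
  imports "HOL-Analysis.Analysis"
begin

section \<open>8-adjacency in the integer plane\<close>

definition adj8 :: "int \<times> int \<Rightarrow> int \<times> int \<Rightarrow> bool" where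
  "adj8 p q \<longleftrightarrow> p \<noteq> q \<and> \<bar>fst p - fst q\<bar> \<le> 1 \<and> \<bar>snd p - snd q\<bar> \<le> 1"

definition connected8 :: "(int \<times> int) set \<Rightarrow> bool" where
  "connected8 S \<longleftrightarrow>
     \<not> (\<exists>P Q. P \<union> Q = S \<and> P \<inter> Q = {} \<and> P \<noteq> {} \<and> Q \<noteq> {} \<and> (\<forall>p\<in>P. \<forall>q\<in>Q. \<not> adj8 p q))"

definition path8 :: "(int \<times> int) set \<Rightarrow> bool" where
  "path8 S \<longleftrightarrow>
     (\<exists>(n::nat) x. n \<ge> 1 \<and> S = x ` {..n} \<and> inj_on x {..n} \<and>
        (\<forall>i j. i < j \<and> j \<le> n \<longrightarrow> (adj8 (x i) (x j) \<longleftrightarrow> j = i + 1)))"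

definition closed_curve8 :: "(int \<times> int) set \<Rightarrow> bool" where
  "closed_curve8 C \<longleftrightarrow>
     finite C \<and> connected8 C \<and> card C \<ge> 4 \<and> (\<forall>p\<in>C. card {q \<in> C. adj8 p q} = 2)"


section \<open>The Khalimsky line and plane\<close>

definition khalimsky_basic :: "int \<Rightarrow> int set" where
  "khalimsky_basic n = (if odd n then {n} else {n - 1, n, n + 1})"

definition khalimsky :: "int topology" where
  "khalimsky = topology_generated_by (range khalimsky_basic)"

definition khalimsky2 :: "(int \<times> int) topology" where
  "khalimsky2 = prod_topology khalimsky khalimsky"

text \<open>The smallest open set containing \<open>x\<close> is obtained as the intersection of all of them; it is
  itself open by \<open>openin_min_nbhd\<close> below.\<close>

definition min_nbhd :: "int \<times> int \<Rightarrow> (int \<times> int) set" where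
  "min_nbhd x = \<Inter>{U. openin khalimsky2 U \<and> x \<in> U}"

definition pt_closure :: "int \<times> int \<Rightarrow> (int \<times> int) set" where
  "pt_closure x = khalimsky2 closure_of {x}"

definition adjacent_set :: "int \<times> int \<Rightarrow> (int \<times> int) set" where
  "adjacent_set x = {y. y \<noteq> x \<and> connectedin khalimsky2 {x, y}}"

definition pure :: "int \<times> int \<Rightarrow> bool" where
  "pure x \<longleftrightarrow> (even (fst x) \<and> even (snd x)) \<or> (odd (fst x) \<and> odd (snd x))"

abbreviation mixed :: "int \<times> int \<Rightarrow> bool" where
  "mixed x \<equiv> \<not> pure x"

definition khalimsky_arc :: "(int \<times> int) set \<Rightarrow> bool" where
  "khalimsky_arc C \<longleftrightarrow>
     (\<exists>a b. a < b \<and> subtopology khalimsky2 C homeomorphic_space subtopology khalimsky {a..b})"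

definition arc_endpoints :: "(int \<times> int) set \<Rightarrow> (int \<times> int) set" where
  "arc_endpoints C = {x \<in> C. card (adjacent_set x \<inter> C) = 1}"

text \<open>As \<open>card\<close> of an infinite set is \<open>0\<close>, the condition \<open>card J \<ge> 4\<close> makes \<open>J\<close> finite. This loses
  nothing, since arcs are finite.\<close>

definition khalimsky_jordan_curve :: "(int \<times> int) set \<Rightarrow> bool" where
  "khalimsky_jordan_curve J \<longleftrightarrow>
     connectedin khalimsky2 J \<and> card J \<ge> 4 \<and> (\<forall>x\<in>J. khalimsky_arc (J - {x}))"

definition Gam :: "int \<times> int \<Rightarrow> int \<times> int" where
  "Gam p = (fst p + snd p, snd p - fst p)"

definition Gam_star :: "(int \<times> int) set \<Rightarrow> (int \<times> int) set" where
  "Gam_star A = Gam ` A \<union>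
     {x. mixed x \<and>
         (min_nbhd x \<subseteq> Gam ` A \<union> {x} \<or> pt_closure x \<subseteq> Gam ` A \<union> {x})}"


section \<open>Basic facts\<close>

lemma topspace_khalimsky [simp]: "topspace khalimsky = UNIV"
proof -
  have "n \<in> khalimsky_basic n" for n
    by (simp add: khalimsky_basic_def)
  then show ?thesis
    by (auto simp: khalimsky_def topology_generated_by_topspace)
qed

lemma topspace_khalimsky2 [simp]: "topspace khalimsky2 = UNIV"
  by (simp add: khalimsky2_def)

lemma openin_khalimsky_basic: "openin khalimsky (khalimsky_basic n)"
  unfolding khalimsky_def by (rule topology_generated_by_Basis) simp

lemma khalimsky_basic_subset:
  assumes "openin khalimsky U" "n \<in> U"
  shows "khalimsky_basic n \<subseteq> U"
proof -
  have "generate_topology_on (range khalimsky_basic) U"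
    using assms(1) by (simp add: khalimsky_def openin_topology_generated_by_iff)
  then show ?thesis
    using assms(2)
  proof (induction arbitrary: n)
    case (Basis s)
    then show ?case
      by (auto simp: khalimsky_basic_def split: if_splits)
  qed blast+
qed

lemma min_nbhd_eq: "min_nbhd x = khalimsky_basic (fst x) \<times> khalimsky_basic (snd x)"
proof
  have "x \<in> khalimsky_basic (fst x) \<times> khalimsky_basic (snd x)"
    by (simp add: mem_Times_iff khalimsky_basic_def)
  then show "min_nbhd x \<subseteq> khalimsky_basic (fst x) \<times> khalimsky_basic (snd x)"
    unfolding min_nbhd_def khalimsky2_def
    by (intro Inter_lower) (simp add: openin_prod_Times_iff openin_khalimsky_basic)
next
  show "khalimsky_basic (fst x) \<times> khalimsky_basic (snd x) \<subseteq> min_nbhd x"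
    unfolding min_nbhd_def
  proof (rule Inter_greatest)
    fix W assume "W \<in> {U. openin khalimsky2 U \<and> x \<in> U}"
    then obtain U V where "openin khalimsky U" "openin khalimsky V"
        "fst x \<in> U" "snd x \<in> V" "U \<times> V \<subseteq> W"
      by (cases x) (simp add: khalimsky2_def openin_prod_topology_alt, blast)
    then show "khalimsky_basic (fst x) \<times> khalimsky_basic (snd x) \<subseteq> W"
      using khalimsky_basic_subset by blast
  qed
qed

lemma openin_min_nbhd: "openin khalimsky2 (min_nbhd x)"
  by (simp add: min_nbhd_eq khalimsky2_def openin_prod_Times_iff openin_khalimsky_basic)

end

theory Submission imports Defs
begin

text \<open>
  A mixed point of the Khalimsky plane has four neighbours, all pure: an opposite pair making up
  its smallest neighbourhood and an opposite pair making up its closure. So \<open>Gam_star A\<close> adds to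
  \<open>Gam ` A\<close> the midpoints of pairs of pure points at axis distance 2, and two points of the
  integer plane are 8-adjacent iff their images under \<open>Gam\<close> are adjacent or form such a pair.
  On an arc the order of specialization alternates, hence a mixed point that is not an endpoint
  lies between an opposite pair of points of the arc; the same holds on a Jordan curve, where every
  point has exactly two neighbours. Therefore \<open>Gam_star (Gam -` C) = C\<close> says that \<open>C\<close> contains
  the midpoint of any two of its pure points at axis distance 2.

  Listing the pure points of \<open>C\<close> in the order of the curve, consecutive ones are 8-adjacent, and the
  condition excludes exactly the additional 8-adjacencies. For arcs, an 8-path with \<open>k + 1\<close>
  points has only \<open>k\<close> adjacencies, all of which the order of the arc uses up. For Jordan curves,
  the same count is made locally: each pure point already has two 8-neighbours.
\<close>

section \<open>Coordinates\<close>

definition adjK :: "int \<times> int \<Rightarrow> int \<times> int \<Rightarrow> bool" where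
  "adjK p q \<longleftrightarrow> p \<noteq> q \<and> (q \<in> min_nbhd p \<or> p \<in> min_nbhd q)"

text \<open>The vector \<open>d\<close> takes both signs along each axis, so \<open>u\<close> and
  \<open>v\<close> form an unordered pair with midpoint \<open>m\<close>.\<close>

definition straddle :: "int \<times> int \<Rightarrow> int \<times> int \<Rightarrow> int \<times> int \<Rightarrow> bool" where
  "straddle m u v \<longleftrightarrow> mixed m \<and>
     (\<exists>d \<in> {(1, 0), (-1, 0), (0, 1), (0, -1)}. u = m + d \<and> v = m - d)"

section \<open>Minimal neighbourhoods and adjacency\<close>

text \<open>Every point has a smallest open neighbourhood, so openness can be tested pointwise and
  topological questions become combinatorial.\<close>

lemma openin_khalimsky2_iff:
  "openin khalimsky2 U \<longleftrightarrow> (\<forall>p\<in>U. min_nbhd p \<subseteq> U)"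
proof
  assume "openin khalimsky2 U"
  then show "\<forall>p\<in>U. min_nbhd p \<subseteq> U"
    by (auto simp: min_nbhd_def)
next
  assume *: "\<forall>p\<in>U. min_nbhd p \<subseteq> U"
  have "p \<in> min_nbhd p" for p
    by (auto simp: min_nbhd_def)
  with * have "U = \<Union> (min_nbhd ` U)"
    by auto
  moreover have "openin khalimsky2 (\<Union> (min_nbhd ` U))"
    by (intro openin_Union) (auto simp: openin_min_nbhd)
  ultimately show "openin khalimsky2 U"
    by simp
qed

lemma min_nbhd_self [simp]: "p \<in> min_nbhd p"
  by (auto simp: min_nbhd_def)

lemma mem_pt_closure: "y \<in> pt_closure x \<longleftrightarrow> x \<in> min_nbhd y"
proof -
  have "y \<in> pt_closure x \<longleftrightarrow> (\<forall>T. y \<in> T \<and> openin khalimsky2 T \<longrightarrow> x \<in> T)"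
    by (auto simp: pt_closure_def in_closure_of)
  also have "\<dots> \<longleftrightarrow> x \<in> min_nbhd y"
    by (auto simp: min_nbhd_def)
  finally show ?thesis .
qed

text \<open>Two points are separated exactly when each minimal neighbourhood misses the other point;
  the two neighbourhoods are then the separation.\<close>

lemma adjacent_set_eq: "adjacent_set x = {y. adjK x y}"
proof -
  have "connectedin khalimsky2 {x, y} \<longleftrightarrow> y \<in> min_nbhd x \<or> x \<in> min_nbhd y" if "y \<noteq> x" for y
  proof
    assume c: "connectedin khalimsky2 {x, y}"
    show "y \<in> min_nbhd x \<or> x \<in> min_nbhd y"
    proof (rule ccontr)
      assume "\<not> ?thesis"
      then have "min_nbhd x \<inter> min_nbhd y \<inter> {x, y} = {}"
        by auto
      moreover have "{x, y} \<subseteq> min_nbhd x \<union> min_nbhd y" "min_nbhd x \<inter> {x, y} \<noteq> {}"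
        "min_nbhd y \<inter> {x, y} \<noteq> {}"
        using min_nbhd_self by blast+
      ultimately show False
        using c connectedinD[OF c openin_min_nbhd openin_min_nbhd, of x y] by simp
    qed
  next
    assume *: "y \<in> min_nbhd x \<or> x \<in> min_nbhd y"
    show "connectedin khalimsky2 {x, y}"
      unfolding connectedin
    proof (intro conjI notI)
      show "{x, y} \<subseteq> topspace khalimsky2" by simp
      assume "\<exists>E1 E2. openin khalimsky2 E1 \<and> openin khalimsky2 E2 \<and> {x, y} \<subseteq> E1 \<union> E2 \<and>
        E1 \<inter> E2 \<inter> {x, y} = {} \<and> E1 \<inter> {x, y} \<noteq> {} \<and> E2 \<inter> {x, y} \<noteq> {}"
      then obtain E1 E2 where "openin khalimsky2 E1" "openin khalimsky2 E2" and
        E: "{x, y} \<subseteq> E1 \<union> E2" "E1 \<inter> E2 \<inter> {x, y} = {}" "E1 \<inter> {x, y} \<noteq> {}" "E2 \<inter> {x, y} \<noteq> {}"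
        by (elim exE conjE)
      then have "\<forall>p\<in>E1. min_nbhd p \<subseteq> E1" "\<forall>p\<in>E2. min_nbhd p \<subseteq> E2"
        by (simp_all only: openin_khalimsky2_iff)
      moreover have "x \<in> E1 \<and> y \<in> E2 \<or> x \<in> E2 \<and> y \<in> E1"
        using E by auto
      ultimately show False
        using * E(2) by auto
    qed
  qed
  then show ?thesis
    by (auto simp: adjacent_set_def adjK_def)
qed

lemma adjK_sym: "adjK p q \<longleftrightarrow> adjK q p"
  by (auto simp: adjK_def)

lemma adjK_irrefl [simp]: "\<not> adjK p p"
  by (simp add: adjK_def)

lemma khalimsky_basic_iff: "j \<in> khalimsky_basic i \<longleftrightarrow> j = i \<or> even i \<and> \<bar>j - i\<bar> = 1"
  by (auto simp: khalimsky_basic_def)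

lemma pure_iff: "pure p \<longleftrightarrow> (even (fst p) \<longleftrightarrow> even (snd p))"
  by (auto simp: pure_def)

text \<open>Once the offset is bounded, nine offsets and four parity classes remain. They show that
  a pure point is adjacent to all eight points around it, a mixed point only to the four along the
  axes.\<close>

lemma adjK_diff:
  "adjK p q \<longleftrightarrow> p \<noteq> q \<and> \<bar>fst p - fst q\<bar> \<le> 1 \<and> \<bar>snd p - snd q\<bar> \<le> 1 \<and>
     (pure p \<or> pure q) \<and> (mixed p \<or> mixed q \<longrightarrow> fst p = fst q \<or> snd p = snd q)"
proof (cases "\<bar>fst p - fst q\<bar> \<le> 1 \<and> \<bar>snd p - snd q\<bar> \<le> 1")
  case False
  then show ?thesis
    by (auto simp: adjK_def min_nbhd_eq khalimsky_basic_iff mem_Times_iff)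
next
  case True
  define i j where "i = fst q - fst p" and "j = snd q - snd p"
  have ij: "i \<in> {-1, 0, 1}" "j \<in> {-1, 0, 1}"
    using True by (auto simp: i_def j_def)
  obtain a b where p: "p = (a, b)" by (cases p)
  have q: "q = (a + i, b + j)"
    by (simp add: i_def j_def p)
  show ?thesis
    using ij unfolding p q
    by (elim insertE emptyE; cases "even a"; cases "even b"; simp add: adjK_def min_nbhd_eq khalimsky_basic_iff pure_iff)
qed

section \<open>The map \<open>Gam\<close>, pure points and opposite pairs\<close>

lemma Gam_eq_iff [simp]: "Gam p = Gam q \<longleftrightarrow> p = q"
  by (auto simp: Gam_def prod_eq_iff)

lemma pure_Gam [simp]: "pure (Gam p)"
  by (auto simp: Gam_def pure_def)

lemma pure_imp_Gam:
  assumes "pure x" shows "x \<in> range Gam"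
proof -
  have "even (fst x - snd x)"
    using assms by (simp add: pure_iff)
  then obtain k where "fst x - snd x = 2 * k"
    by (elim evenE)
  then have "x = Gam (k, k + snd x)"
    by (simp add: Gam_def prod_eq_iff)
  then show ?thesis
    by (rule range_eqI)
qed

lemma Gam_image_vimage: "Gam ` (Gam -` C) = {x \<in> C. pure x}"
proof
  show "{x \<in> C. pure x} \<subseteq> Gam ` (Gam -` C)"
    by (auto dest!: pure_imp_Gam)
qed auto

lemma straddle_pure: "straddle m u v \<Longrightarrow> mixed m \<and> pure u \<and> pure v"
  by (auto simp: straddle_def pure_def)

lemma straddle_adj: "straddle m u v \<Longrightarrow> adjK m u \<and> adjK m v \<and> u \<noteq> v \<and> \<not> adjK u v"
  by (frule straddle_pure, cases m) (auto simp: straddle_def adjK_diff)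

lemma straddle_sym: "straddle m u v \<longleftrightarrow> straddle m v u"
  by (cases m) (auto simp: straddle_def)

lemma straddle_unique_end: "straddle m u v \<Longrightarrow> straddle m u w \<Longrightarrow> v = w"
  by (auto simp: straddle_def prod_eq_iff)

lemma straddle_unique_mid: "straddle m u v \<Longrightarrow> straddle m' u v \<Longrightarrow> m = m'"
  by (auto simp: straddle_def prod_eq_iff)

lemma mixed_min_nbhd:
  "mixed m \<Longrightarrow> min_nbhd m =
     (if even (fst m) then {m, m + (1, 0), m - (1, 0)} else {m, m + (0, 1), m - (0, 1)})"
proof -
  assume m: "mixed m"
  have "{a, a - 1, a + 1} \<times> {b} = {(a, b), (a - 1, b), (a + 1, b)}"
    "{a} \<times> {b, b - 1, b + 1} = {(a, b), (a, b - 1), (a, b + 1)}" for a b :: int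
    by blast+
  with m show ?thesis
    by (cases m; cases "even (fst m)")
      (simp_all add: min_nbhd_eq khalimsky_basic_def pure_iff insert_commute del: insert_Times_insert)
qed

text \<open>Read from the side of \<open>c\<close>, the relation describes closures in the line:
  basic neighbourhoods with even and odd exchanged. Hence the closure of a mixed point lies across
  its neighbourhood.\<close>

lemma mem_khalimsky_basic_dual:
  "a \<in> khalimsky_basic c \<longleftrightarrow> c \<in> (if odd a then {a - 1, a, a + 1} else {a})"
proof (cases "c \<in> {a - 1, a, a + 1}")
  case True
  then show ?thesis by (elim insertE emptyE) (simp_all add: khalimsky_basic_def)
next
  case False
  then show ?thesis by (auto simp: khalimsky_basic_def)
qed

lemma mixed_pt_closure:
  assumes "mixed m"
  shows "pt_closure m =
     (if even (fst m) then {m, m + (0, 1), m - (0, 1)} else {m, m + (1, 0), m - (1, 0)})"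
proof -
  have "pt_closure m = {c. fst m \<in> khalimsky_basic c} \<times> {c. snd m \<in> khalimsky_basic c}"
    by (auto simp: mem_pt_closure min_nbhd_eq mem_Times_iff)
  then show ?thesis
    using assms unfolding mem_khalimsky_basic_dual by (cases m) (auto simp: pure_iff)
qed

text \<open>Each of the two sets consists of \<open>m\<close> and one opposite pair, so two distinct
  further points can only be that pair.\<close>

lemma straddle_nbhd:
  assumes m: "mixed m" and ne: "u \<noteq> v" "u \<noteq> m" "v \<noteq> m"
    and "{u, v} \<subseteq> min_nbhd m \<or> {u, v} \<subseteq> pt_closure m"
  shows "straddle m u v"
proof -
  have "{u, v} \<subseteq> {m, m + (1, 0), m - (1, 0)} \<or> {u, v} \<subseteq> {m, m + (0, 1), m - (0, 1)}"
    using assms(5) unfolding mixed_min_nbhd[OF m] mixed_pt_closure[OF m]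
    by (cases "even (fst m)") (simp_all only: if_True if_False not_True_eq_False, blast+)
  then have "{u, v} = {m + (1, 0), m - (1, 0)} \<or> {u, v} = {m + (0, 1), m - (0, 1)}"
    using ne by blast
  then show ?thesis
    using m by (auto simp: straddle_def doubleton_eq_iff minus_prod_def plus_prod_def)
qed

lemma straddle_Gam_imp_adj8:
  assumes "straddle m (Gam p) (Gam q)" shows "adj8 p q"
proof -
  obtain d where d: "d \<in> {(1, 0), (-1, 0), (0, 1), (0, -1)}" "Gam p = m + d" "Gam q = m - d"
    using assms by (auto simp: straddle_def)
  \<comment> \<open>Solving for the coordinate differences of \<open>p\<close> and \<open>q\<close>
    gives \<open>fst d - snd d\<close> and \<open>fst d + snd d\<close>, each of absolute value 1: a
    diagonal step.\<close>
  then have "fst p + snd p - (fst q + snd q) = 2 * fst d"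
    "snd p - fst p - (snd q - fst q) = 2 * snd d"
    by (auto simp: Gam_def prod_eq_iff)
  then show ?thesis
    using d(1) unfolding adj8_def prod_eq_iff by auto
qed

lemma adj8_imp_cases:
  assumes "adj8 p q" shows "adjK (Gam p) (Gam q) \<or> (\<exists>m. straddle m (Gam p) (Gam q))"
proof (cases "fst p = fst q \<or> snd p = snd q")
  case True
  then show ?thesis
    using assms unfolding adjK_diff by (auto simp: adj8_def Gam_def pure_def prod_eq_iff)
next
  case False
  \<comment> \<open>Half of \<open>Gam p - Gam q\<close>, tabulated for the four diagonal
    steps.\<close>
  define d where "d = (if fst q = fst p + 1 then (if snd q = snd p + 1 then (-1, 0) else (0, 1))
    else (if snd q = snd p + 1 then (0, -1) else (1 :: int, 0 :: int)))"
  have "straddle (Gam p - d) (Gam p) (Gam q)"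
    using False assms unfolding straddle_def d_def
    by (auto simp: adj8_def Gam_def pure_def prod_eq_iff)
  then show ?thesis by blast
qed

lemma adj8_iff: "adj8 p q \<longleftrightarrow> adjK (Gam p) (Gam q) \<or> (\<exists>m. straddle m (Gam p) (Gam q))"
proof -
  have "adjK (Gam p) (Gam q) \<Longrightarrow> adj8 p q"
    by (auto simp: adjK_diff adj8_def Gam_def)
  then show ?thesis
    using straddle_Gam_imp_adj8 adj8_imp_cases by blast
qed

lemma Gam_star_eq:
  "Gam_star A = Gam ` A \<union> {m. \<exists>u\<in>Gam ` A. \<exists>v\<in>Gam ` A. straddle m u v}"
proof -
  have "min_nbhd m \<subseteq> Gam ` A \<union> {m} \<or> pt_closure m \<subseteq> Gam ` A \<union> {m} \<longleftrightarrow>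
    (\<exists>u\<in>Gam ` A. \<exists>v\<in>Gam ` A. straddle m u v)" if m: "mixed m" for m
  proof -
    have general: "(\<exists>d\<in>D. m + d \<in> G \<and> m - d \<in> G) \<longleftrightarrow>
      (\<exists>u\<in>G. \<exists>v\<in>G. mixed m \<and> (\<exists>d\<in>D. u = m + d \<and> v = m - d))" for D G
      using m by blast
    define h where "h = {m, m + (1, 0), m - (1, 0)}"
    define v where "v = {m, m + (0, 1), m - (0, 1)}"
    \<comment> \<open>The parity of \<open>m\<close> decides which of the two sets is horizontal;
      comparing unordered pairs makes the distinction irrelevant.\<close>
    have "{min_nbhd m, pt_closure m} = {h, v}"
      using m by (auto simp: mixed_min_nbhd mixed_pt_closure h_def v_def)
    then have "min_nbhd m \<subseteq> Gam ` A \<union> {m} \<or> pt_closure m \<subseteq> Gam ` A \<union> {m} \<longleftrightarrow>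
      h \<subseteq> Gam ` A \<union> {m} \<or> v \<subseteq> Gam ` A \<union> {m}"
      by (auto simp: doubleton_eq_iff)
    also have "\<dots> \<longleftrightarrow> (\<exists>d \<in> {(1, 0), (-1, 0), (0, 1), (0, -1)}. m + d \<in> Gam ` A \<and> m - d \<in> Gam ` A)"
      by (auto simp: h_def v_def prod_eq_iff minus_prod_def plus_prod_def)
    also have "\<dots> \<longleftrightarrow> (\<exists>u\<in>Gam ` A. \<exists>v\<in>Gam ` A. straddle m u v)"
      using general unfolding straddle_def .
    finally show ?thesis .
  qed
  then show ?thesis
    unfolding Gam_star_def using straddle_pure by blast
qed

section \<open>Arcs\<close>

text \<open>This is the specialization preorder. Each implication pulls an open set back along one
  of the two continuous maps.\<close>

lemma homeomorphic_maps_specialization: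
  assumes h: "homeomorphic_maps X Y f g" and "p \<in> topspace X" "q \<in> topspace X"
  shows "(\<forall>U. openin X U \<and> p \<in> U \<longrightarrow> q \<in> U) \<longleftrightarrow> (\<forall>V. openin Y V \<and> f p \<in> V \<longrightarrow> f q \<in> V)"
proof
  assume L: "\<forall>U. openin X U \<and> p \<in> U \<longrightarrow> q \<in> U"
  show "\<forall>V. openin Y V \<and> f p \<in> V \<longrightarrow> f q \<in> V"
  proof (intro allI impI)
    fix V assume V: "openin Y V \<and> f p \<in> V"
    have "openin X {x \<in> topspace X. f x \<in> V}"
      using h V by (auto simp: homeomorphic_maps_def continuous_map_def)
    then show "f q \<in> V"
      using L V assms(2) by fastforce
  qed
next
  assume R: "\<forall>V. openin Y V \<and> f p \<in> V \<longrightarrow> f q \<in> V"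
  have gf: "g (f p) = p" "g (f q) = q" and fp: "f p \<in> topspace Y"
    using assms by (auto simp: homeomorphic_maps_def continuous_map_def)
  show "\<forall>U. openin X U \<and> p \<in> U \<longrightarrow> q \<in> U"
  proof (intro allI impI)
    fix U assume U: "openin X U \<and> p \<in> U"
    have "openin Y {y \<in> topspace Y. g y \<in> U}"
      using h U by (auto simp: homeomorphic_maps_def continuous_map_def)
    moreover have "f p \<in> {y \<in> topspace Y. g y \<in> U}"
      using U gf(1) fp by simp
    ultimately have "f q \<in> {y \<in> topspace Y. g y \<in> U}"
      using R by blast
    then show "q \<in> U"
      using gf by simp
  qed
qed

lemma specialization_khalimsky2:
  assumes "p \<in> C" "q \<in> C"
  shows "(\<forall>U. openin (subtopology khalimsky2 C) U \<and> p \<in> U \<longrightarrow> q \<in> U) \<longleftrightarrow> q \<in> min_nbhd p"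
  using assms by (auto simp: openin_subtopology min_nbhd_def)

lemma specialization_khalimsky:
  assumes "i \<in> S" "j \<in> S"
  shows "(\<forall>U. openin (subtopology khalimsky S) U \<and> i \<in> U \<longrightarrow> j \<in> U) \<longleftrightarrow> j \<in> khalimsky_basic i"
proof
  assume "\<forall>U. openin (subtopology khalimsky S) U \<and> i \<in> U \<longrightarrow> j \<in> U"
  moreover have "openin (subtopology khalimsky S) (S \<inter> khalimsky_basic i)"
    using openin_khalimsky_basic openin_subtopology_Int2 by blast
  ultimately show "j \<in> khalimsky_basic i"
    using assms by (force simp: khalimsky_basic_iff)
next
  assume "j \<in> khalimsky_basic i"
  then show "\<forall>U. openin (subtopology khalimsky S) U \<and> i \<in> U \<longrightarrow> j \<in> U"
    using assms khalimsky_basic_subset by (auto simp: openin_subtopology)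
qed

text \<open>An induced path with \<open>n + 1\<close> vertices in the graph \<open>R\<close>. The
  relation is a parameter because arcs, 8-paths and the images of 8-paths under \<open>Gam\<close>
  all have this form.\<close>

definition path_enum :: "('a \<Rightarrow> 'a \<Rightarrow> bool) \<Rightarrow> nat \<Rightarrow> (nat \<Rightarrow> 'a) \<Rightarrow> 'a set \<Rightarrow> bool" where
  "path_enum R n g S \<longleftrightarrow> bij_betw g {..n} S \<and>
     (\<forall>i\<le>n. \<forall>j\<le>n. R (g i) (g j) \<longleftrightarrow> i = Suc j \<or> j = Suc i)"

text \<open>The homeomorphism preserves specialization, hence adjacency. In an interval, an interior
  point lies on the same side of both neighbours in this order, which at a mixed point of
  \<open>C\<close> leaves only an opposite pair.\<close>

lemma khalimsky_arc_enum:
  assumes "khalimsky_arc C"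
  obtains n g where "n \<ge> 1" "path_enum adjK n g C"
    "\<And>i. Suc (Suc i) \<le> n \<Longrightarrow> mixed (g (Suc i)) \<Longrightarrow> straddle (g (Suc i)) (g i) (g (Suc (Suc i)))"
proof -
  obtain a b where ab: "a < b"
    and "subtopology khalimsky2 C homeomorphic_space subtopology khalimsky {a..b}"
    using assms by (auto simp: khalimsky_arc_def)
  then obtain f e where ef: "homeomorphic_maps (subtopology khalimsky {a..b}) (subtopology khalimsky2 C) f e"
    unfolding homeomorphic_space_def using homeomorphic_maps_sym by blast
  then have "homeomorphic_map (subtopology khalimsky {a..b}) (subtopology khalimsky2 C) f"
    by (auto simp: homeomorphic_map_maps)
  then have bij: "bij_betw f {a..b} C"
    using homeomorphic_imp_injective_map homeomorphic_imp_surjective_map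
    by (fastforce simp: bij_betw_def)
  have spec: "f j \<in> min_nbhd (f i) \<longleftrightarrow> j \<in> khalimsky_basic i" if "i \<in> {a..b}" "j \<in> {a..b}" for i j
  proof -
    have "f i \<in> C" "f j \<in> C"
      using bij that by (auto simp: bij_betw_def)
    with homeomorphic_maps_specialization[OF ef, of i j] that show ?thesis
      by (simp add: specialization_khalimsky specialization_khalimsky2)
  qed
  define n where "n = nat (b - a)"
  define g where "g i = f (a + int i)" for i
  have mem: "a + int i \<in> {a..b}" if "i \<le> n" for i
    using that ab by (auto simp: n_def)
  have "bij_betw (\<lambda>i. a + int i) {..n} {a..b}"
    by (rule bij_betwI[where g = "\<lambda>j. nat (j - a)"]) (use ab in \<open>auto simp: n_def\<close>)
  then have bijg: "bij_betw g {..n} C"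
    using bij_betw_trans[OF _ bij] unfolding g_def o_def by blast
  have gspec: "g j \<in> min_nbhd (g i) \<longleftrightarrow> a + int j \<in> khalimsky_basic (a + int i)"
    if "i \<le> n" "j \<le> n" for i j
    unfolding g_def using spec mem that by blast
  have geq: "g i = g j \<longleftrightarrow> i = j" if "i \<le> n" "j \<le> n" for i j
    using bijg that by (auto simp: bij_betw_def inj_on_eq_iff)
  show ?thesis
  proof
    show "n \<ge> 1"
      using ab by (simp add: n_def)
    have "adjK (g i) (g j) \<longleftrightarrow> i = Suc j \<or> j = Suc i" if ij: "i \<le> n" "j \<le> n" for i j
    proof -
      have "adjK (g i) (g j) \<longleftrightarrow> i \<noteq> j \<and> \<bar>int i - int j\<bar> = 1 \<and> (even (a + int i) \<or> even (a + int j))"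
        unfolding adjK_def by (auto simp: gspec geq ij khalimsky_basic_iff)
      also have "\<dots> \<longleftrightarrow> i = Suc j \<or> j = Suc i"
        by (auto simp: abs_if split: if_splits)
      finally show ?thesis .
    qed
    then show "path_enum adjK n g C"
      using bijg by (simp add: path_enum_def)
  next
    fix i assume i: "Suc (Suc i) \<le> n" and m: "mixed (g (Suc i))"
    \<comment> \<open>If \<open>a + Suc i\<close> is even, its basic neighbourhood contains both
      neighbours; if it is odd, it lies in the basic neighbourhoods of both.\<close>
    have "{g i, g (Suc (Suc i))} \<subseteq> min_nbhd (g (Suc i)) \<or>
        {g i, g (Suc (Suc i))} \<subseteq> pt_closure (g (Suc i))"
      using i by (auto simp: mem_pt_closure gspec khalimsky_basic_iff)
    then show "straddle (g (Suc i)) (g i) (g (Suc (Suc i)))"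
      using i m by (intro straddle_nbhd) (auto simp: geq)
  qed
qed

section \<open>Counting the edges of a path\<close>

text \<open>Each of the \<open>n\<close> edges is counted in both orientations; injectivity keeps
  the two families disjoint.\<close>

lemma card_consecutive_pairs:
  assumes "inj_on g {..n}"
  shows "card ((\<lambda>i. (g i, g (Suc i))) ` {..<n} \<union> (\<lambda>i. (g (Suc i), g i)) ` {..<n}) = 2 * n"
proof -
  have eq: "g i = g j \<longleftrightarrow> i = j" if "i \<le> n" "j \<le> n" for i j
    using assms that by (auto simp: inj_on_eq_iff)
  have "card ((\<lambda>i. (g i, g (Suc i))) ` {..<n}) = n" "card ((\<lambda>i. (g (Suc i), g i)) ` {..<n}) = n"
    by (auto simp: card_image inj_on_def eq)
  moreover have "(\<lambda>i. (g i, g (Suc i))) ` {..<n} \<inter> (\<lambda>i. (g (Suc i), g i)) ` {..<n} = {}"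
    by (auto simp: eq)
  ultimately show ?thesis
    by (simp add: card_Un_disjoint)
qed

lemma path_enum_pairs:
  assumes "path_enum R n g S"
  shows "{(p, q). p \<in> S \<and> q \<in> S \<and> R p q} =
    (\<lambda>i. (g i, g (Suc i))) ` {..<n} \<union> (\<lambda>i. (g (Suc i), g i)) ` {..<n}" (is "?L = ?R")
proof -
  have S: "S = g ` {..n}"
    using assms by (auto simp: path_enum_def bij_betw_def)
  have R: "R (g i) (g j) \<longleftrightarrow> i = Suc j \<or> j = Suc i" if "i \<le> n" "j \<le> n" for i j
    using assms that by (auto simp: path_enum_def)
  have "?L \<subseteq> ?R"
  proof (rule subrelI)
    fix p q assume "(p, q) \<in> ?L"
    then obtain i j where ij: "i \<le> n" "j \<le> n" "p = g i" "q = g j" "R p q"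
      by (auto simp: S)
    with R have "i = Suc j \<or> j = Suc i"
      by auto
    with ij show "(p, q) \<in> ?R"
      by auto
  qed
  moreover have "?R \<subseteq> ?L"
    by (auto simp: S R)
  ultimately show ?thesis ..
qed

lemma card_path_enum_pairs:
  "path_enum R n g S \<Longrightarrow> card {(p, q). p \<in> S \<and> q \<in> S \<and> R p q} = 2 * n"
  using card_consecutive_pairs by (subst path_enum_pairs) (auto simp: path_enum_def bij_betw_def)

section \<open>8-adjacency carried to the pure points\<close>

definition adjP :: "int \<times> int \<Rightarrow> int \<times> int \<Rightarrow> bool" where
  "adjP u v \<longleftrightarrow> adjK u v \<or> (\<exists>m. straddle m u v)"

definition straddle_closed :: "(int \<times> int) set \<Rightarrow> bool" where
  "straddle_closed C \<longleftrightarrow> (\<forall>u\<in>C. \<forall>v\<in>C. \<forall>m. straddle m u v \<longrightarrow> m \<in> C)"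

lemma adjP_sym: "adjP u v \<longleftrightarrow> adjP v u"
  unfolding adjP_def using adjK_sym straddle_sym by blast

lemma adjP_irrefl [simp]: "\<not> adjP u u"
  by (metis adjP_def adjK_irrefl straddle_adj)

lemma adj8_adjP: "adj8 p q \<longleftrightarrow> adjP (Gam p) (Gam q)"
  by (simp add: adj8_iff adjP_def)

lemma adj8_sym: "adj8 p q \<longleftrightarrow> adj8 q p"
  unfolding adj8_adjP by (rule adjP_sym)

text \<open>The pure points of \<open>C\<close> always belong to the left-hand set, and the
  hypothesis adds its mixed points. What remains is the reverse inclusion, which is
  \<open>straddle_closed\<close>.\<close>

lemma Gam_star_fixed_iff:
  assumes "\<And>m. m \<in> C \<Longrightarrow> mixed m \<Longrightarrow> \<exists>u\<in>C. \<exists>v\<in>C. straddle m u v"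
  shows "Gam_star (Gam -` C) = C \<longleftrightarrow> straddle_closed C"
  unfolding Gam_star_eq Gam_image_vimage straddle_closed_def
  using assms straddle_pure by blast

lemma path8_iff: "path8 S \<longleftrightarrow> (\<exists>n x. n \<ge> 1 \<and> path_enum adj8 n x S)"
proof -
  have "S = x ` {..n} \<and> inj_on x {..n} \<and>
      (\<forall>i j. i < j \<and> j \<le> n \<longrightarrow> (adj8 (x i) (x j) \<longleftrightarrow> j = i + 1)) \<longleftrightarrow> path_enum adj8 n x S" for n x
  proof -
    have "(\<forall>i j. i < j \<and> j \<le> n \<longrightarrow> (adj8 (x i) (x j) \<longleftrightarrow> j = i + 1)) \<longleftrightarrow>
      (\<forall>i\<le>n. \<forall>j\<le>n. adj8 (x i) (x j) \<longleftrightarrow> i = Suc j \<or> j = Suc i)" (is "?L \<longleftrightarrow> ?R")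
    proof
      assume L: ?L
      show ?R
      proof (intro allI impI)
        fix i j assume "i \<le> n" "j \<le> n"
        then show "adj8 (x i) (x j) \<longleftrightarrow> i = Suc j \<or> j = Suc i"
        proof (cases i j rule: linorder_cases)
          case less
          then show ?thesis using L \<open>j \<le> n\<close> by auto
        next
          case equal
          then show ?thesis by (simp add: adj8_def)
        next
          case greater
          then show ?thesis using L \<open>i \<le> n\<close> by (auto simp: adj8_sym[of "x i"])
        qed
      qed
    qed auto
    then show ?thesis
      by (auto simp: path_enum_def bij_betw_def)
  qed
  then show ?thesis
    unfolding path8_def by blast
qed

lemma path_enum_vimage:
  "(\<exists>x. path_enum adj8 n x (Gam -` C)) \<longleftrightarrow> (\<exists>h. path_enum adjP n h {x \<in> C. pure x})"
proof
  assume "\<exists>x. path_enum adj8 n x (Gam -` C)"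
  then obtain x where x: "path_enum adj8 n x (Gam -` C)" ..
  have "bij_betw Gam (Gam -` C) {x \<in> C. pure x}"
    using Gam_image_vimage by (simp add: bij_betw_def inj_on_def del: image_vimage_eq)
  then have "path_enum adjP n (Gam \<circ> x) {x \<in> C. pure x}"
    using x by (auto simp: path_enum_def adj8_adjP intro: bij_betw_trans)
  then show "\<exists>h. path_enum adjP n h {x \<in> C. pure x}"
    by blast
next
  assume "\<exists>h. path_enum adjP n h {x \<in> C. pure x}"
  then obtain h where h: "path_enum adjP n h {x \<in> C. pure x}" ..
  \<comment> \<open>\<open>inv Gam\<close> is a right inverse only on the range of
    \<open>Gam\<close>, the pure points.\<close>
  have Gam_inv: "Gam (inv Gam y) = y" if "pure y" for y
    using that by (simp add: f_inv_into_f pure_imp_Gam)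
  have "bij_betw (inv Gam) {x \<in> C. pure x} (Gam -` C)"
    by (rule bij_betwI[where g = Gam]) (auto simp: Gam_inv inj_def)
  moreover have "pure (h i)" if "i \<le> n" for i
    using h that by (auto simp: path_enum_def bij_betw_def)
  ultimately have "path_enum adj8 n (inv Gam \<circ> h) (Gam -` C)"
    using h by (auto simp: path_enum_def adj8_adjP Gam_inv intro: bij_betw_trans)
  then show "\<exists>x. path_enum adj8 n x (Gam -` C)"
    by blast
qed

lemma path8_vimage: "path8 (Gam -` C) \<longleftrightarrow> (\<exists>n h. n \<ge> 1 \<and> path_enum adjP n h {x \<in> C. pure x})"
  unfolding path8_iff using path_enum_vimage by blast

section \<open>The pure points along an arc\<close>

text \<open>Turns purity of the endpoints into purity of the first and last enumerated
  points.\<close>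

lemma arc_ends:
  assumes "n \<ge> 1" "path_enum adjK n g C"
  shows "{g 0, g n} \<subseteq> arc_endpoints C"
proof -
  have C: "C = g ` {..n}"
    using assms by (auto simp: path_enum_def bij_betw_def)
  have adj: "adjK (g i) (g j) \<longleftrightarrow> i = Suc j \<or> j = Suc i" if "i \<le> n" "j \<le> n" for i j
    using assms that by (auto simp: path_enum_def)
  have "adjacent_set (g 0) \<inter> C = {g 1}" "adjacent_set (g n) \<inter> C = {g (n - 1)}"
    using assms(1) by (auto simp: adjacent_set_eq C adj)
  then show ?thesis
    by (auto simp: arc_endpoints_def C)
qed

text \<open>Two mixed points are never adjacent, so at most one of them separates successive pure
  points. The map \<open>r\<close> lists the pure positions in increasing order.\<close>

lemma pure_subsequence:
  assumes n: "n \<ge> 1" and g: "path_enum adjK n g C" and ends: "pure (g 0)" "pure (g n)"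
  obtains k r where "k \<ge> 1" "bij_betw (g \<circ> r) {..k} {x \<in> C. pure x}"
    "\<And>i. i < k \<Longrightarrow> r (Suc i) \<le> n \<and> (r (Suc i) = Suc (r i) \<or>
       r (Suc i) = Suc (Suc (r i)) \<and> mixed (g (Suc (r i))))"
    "\<And>i j. i < j \<Longrightarrow> j \<le> k \<Longrightarrow> r i < r j \<and> r j \<le> n"
proof -
  have C: "C = g ` {..n}" and inj: "inj_on g {..n}"
    using g by (auto simp: path_enum_def bij_betw_def)
  have adj: "adjK (g i) (g j) \<longleftrightarrow> i = Suc j \<or> j = Suc i" if "i \<le> n" "j \<le> n" for i j
    using g that by (auto simp: path_enum_def)
  define I where "I = {i. i \<le> n \<and> pure (g i)}"
  have fin: "finite I"
    by (simp add: I_def)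
  have "{0, n} \<subseteq> I"
    using ends by (simp add: I_def)
  \<comment> \<open>The two ends are distinct pure positions, which later gives
    \<open>k \<ge> 1\<close>.\<close>
  then have "card {0, n} \<le> card I"
    using fin by (rule card_mono[rotated])
  then have card: "card I \<ge> 2"
    using n by simp
  obtain r where bij: "bij_betw r {..<card I} I" and "strict_mono_on {..<card I} r"
    using ex_bij_betw_strict_mono_card[OF fin] .
  then have less: "r i < r j \<longleftrightarrow> i < j" if "i < card I" "j < card I" for i j
    using that strict_mono_on_less by blast
  have rI: "r i \<in> I" if "i < card I" for i
    using bij that by (auto simp: bij_betw_def)
  have succ_le: "r (Suc i) \<le> j" if "r i < j" "j \<in> I" "Suc i < card I" for i j
  proof -
    obtain l where l: "l < card I" "j = r l"
      using bij \<open>j \<in> I\<close> by (auto simp: bij_betw_def)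
    with that less have "i < l"
      by auto
    with l that less[of l "Suc i"] show ?thesis
      by auto
  qed
  define k where "k = card I - 1"
  have k: "{..k} = {..<card I}"
    using card by (auto simp: k_def)
  have "bij_betw g I {x \<in> C. pure x}"
    using inj by (auto simp: bij_betw_def I_def C inj_on_def)
  then have "bij_betw (g \<circ> r) {..k} {x \<in> C. pure x}"
    using bij unfolding k by (rule bij_betw_trans[rotated])
  moreover have "r (Suc i) \<le> n \<and> (r (Suc i) = Suc (r i) \<or>
       r (Suc i) = Suc (Suc (r i)) \<and> mixed (g (Suc (r i))))" if "i < k" for i
  proof -
    have i: "Suc i < card I"
      using that by (simp add: k_def)
    then have lt: "r i < r (Suc i)" and le: "r (Suc i) \<le> n"
      using less rI[of "Suc i"] by (auto simp: I_def)
    show ?thesis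
    proof (cases "Suc (r i) \<in> I")
      case True
      then show ?thesis
        using succ_le[OF _ True i] lt le by simp
    next
      case False
      then have m: "mixed (g (Suc (r i)))"
        using lt le by (simp add: I_def)
      have ne: "r (Suc i) \<noteq> Suc (r i)"
        using False rI[OF i] by auto
      then have "Suc (Suc (r i)) \<le> n"
        using lt le by simp
      moreover from this have "adjK (g (Suc (r i))) (g (Suc (Suc (r i))))"
        by (simp add: adj)
      ultimately have "Suc (Suc (r i)) \<in> I"
        using m by (auto simp: I_def adjK_diff)
      then have "r (Suc i) \<le> Suc (Suc (r i))"
        using succ_le i by simp
      then show ?thesis
        using lt le ne m by simp
    qed
  qed
  moreover have "r i < r j \<and> r j \<le> n" if "i < j" "j \<le> k" for i j
    using that less[of i j] rI[of j] card by (auto simp: k_def I_def)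
  ultimately show ?thesis
    using that[of k r] card by (simp add: k_def)
qed

text \<open>Both ends are pure, so a mixed point has a predecessor and a successor in the
  enumeration.\<close>

lemma arc_mixed_straddled:
  assumes "path_enum adjK n g C" "pure (g 0)" "pure (g n)"
    and "\<And>i. Suc (Suc i) \<le> n \<Longrightarrow> mixed (g (Suc i)) \<Longrightarrow> straddle (g (Suc i)) (g i) (g (Suc (Suc i)))"
    and "m \<in> C" "mixed m"
  shows "\<exists>u\<in>C. \<exists>v\<in>C. straddle m u v"
proof -
  have C: "C = g ` {..n}"
    using assms by (auto simp: path_enum_def bij_betw_def)
  then obtain l where l: "l \<le> n" "m = g l"
    using assms by auto
  with assms(2,3,6) have "l \<noteq> 0" "l \<noteq> n"
    by metis+
  then obtain i where i: "l = Suc i" "Suc (Suc i) \<le> n"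
    using l(1) by (cases l) auto
  with assms(4,6) l have "straddle m (g i) (g (Suc (Suc i)))"
    by auto
  moreover have "g i \<in> C" "g (Suc (Suc i)) \<in> C"
    using C i by auto
  ultimately show ?thesis
    by blast
qed

lemma arc_path8_iff:
  assumes C: "khalimsky_arc C" and ends: "\<forall>x\<in>arc_endpoints C. pure x"
  shows "path8 (Gam -` C) \<longleftrightarrow> Gam_star (Gam -` C) = C"
proof -
  obtain n g where n: "n \<ge> 1" and g: "path_enum adjK n g C" and
    str: "\<And>i. Suc (Suc i) \<le> n \<Longrightarrow> mixed (g (Suc i)) \<Longrightarrow> straddle (g (Suc i)) (g i) (g (Suc (Suc i)))"
    using khalimsky_arc_enum[OF C] by blast
  have Cg: "C = g ` {..n}"
    using g by (auto simp: path_enum_def bij_betw_def)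
  have adj: "adjK (g i) (g j) \<longleftrightarrow> i = Suc j \<or> j = Suc i" if "i \<le> n" "j \<le> n" for i j
    using g that by (auto simp: path_enum_def)
  have pure_ends: "pure (g 0)" "pure (g n)"
    using arc_ends[OF n g] ends by auto
  obtain k r where k: "k \<ge> 1" and bij: "bij_betw (g \<circ> r) {..k} {x \<in> C. pure x}"
    and step: "\<And>i. i < k \<Longrightarrow> r (Suc i) \<le> n \<and> (r (Suc i) = Suc (r i) \<or>
       r (Suc i) = Suc (Suc (r i)) \<and> mixed (g (Suc (r i))))"
    and less: "\<And>i j. i < j \<Longrightarrow> j \<le> k \<Longrightarrow> r i < r j \<and> r j \<le> n"
    using pure_subsequence[OF n g pure_ends] by blast
  define h where "h = g \<circ> r"
  have hC: "h i \<in> C" "pure (h i)" if "i \<le> k" for i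
    using bij that by (auto simp: h_def bij_betw_def)
  have chain: "adjK (h i) (h (Suc i)) \<or>
      straddle (g (Suc (r i))) (h i) (h (Suc i)) \<and> g (Suc (r i)) \<in> C" if "i < k" for i
    using step[OF that] less[of i "Suc i"] str[of "r i"] that by (auto simp: h_def adj Cg)
  have chainP: "adjP (h i) (h (Suc i))" if "i < k" for i
    using chain[OF that] unfolding adjP_def by blast
  have "path8 (Gam -` C) \<longleftrightarrow> straddle_closed C"
  proof
    assume "straddle_closed C"
    have "j = Suc i" if ij: "i < j" "j \<le> k" and "adjP (h i) (h j)" for i j
    proof -
      have le: "r i < r j" "r i \<le> n" "r j \<le> n"
        using less[OF ij] by auto
      \<comment> \<open>Positions suffice, as \<open>r\<close> is strictly increasing. Adjacency
        puts \<open>r j\<close> right after \<open>r i\<close>; a midpoint in \<open>C\<close> takes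
        the single position between them and, being mixed, is skipped by \<open>r\<close>.\<close>
      have "r (Suc i) = r j"
        using \<open>adjP (h i) (h j)\<close> unfolding adjP_def
      proof
        assume "adjK (h i) (h j)"
        then have "r j = Suc (r i)"
          using le by (auto simp: h_def adj)
        then show ?thesis
          using step[of i] less[of "Suc i" j] ij by (cases "j = Suc i") auto
      next
        assume "\<exists>m. straddle m (h i) (h j)"
        then obtain m where m: "straddle m (h i) (h j)" ..
        then have "m \<in> C"
          using \<open>straddle_closed C\<close> hC ij unfolding straddle_closed_def by (meson less_imp_le order_trans)
        then obtain l where l: "l \<le> n" "m = g l"
          using Cg by auto
        have "adjK m (h i)" "adjK m (h j)"
          using straddle_adj[OF m] by auto
        then have "l = Suc (r i)" "r j = Suc l"
          using l le by (auto simp: h_def adj)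
        moreover have "r (Suc i) \<noteq> l"
          using straddle_pure[OF m] hC(2)[of "Suc i"] ij l by (auto simp: h_def)
        ultimately show ?thesis
          using step[of i] ij by auto
      qed
      then show ?thesis
        using less[of "Suc i" j] ij by (cases "j = Suc i") auto
    qed
    then have ordered: "adjP (h i) (h j) \<longleftrightarrow> j = Suc i" if "i < j" "j \<le> k" for i j
      using that chainP by (metis Suc_le_lessD Suc_le_eq)
    have "adjP (h i) (h j) \<longleftrightarrow> i = Suc j \<or> j = Suc i" if "i \<le> k" "j \<le> k" for i j
    proof (cases i j rule: linorder_cases)
      case less
      then show ?thesis using ordered[OF less that(2)] by simp
    next
      case equal
      then show ?thesis by simp
    next
      case greater
      then show ?thesis using ordered[OF greater that(1)] adjP_sym[of "h i"] by simp
    qed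
    then have "path_enum adjP k h {x \<in> C. pure x}"
      using bij by (simp add: path_enum_def h_def)
    then show "path8 (Gam -` C)"
      using path8_vimage k by blast
  next
    assume "path8 (Gam -` C)"
    then obtain k' h' where h': "path_enum adjP k' h' {x \<in> C. pure x}"
      by (auto simp: path8_vimage)
    \<comment> \<open>\<open>E\<close> holds all 8-adjacencies among the pure points,
      \<open>F\<close> those given by the order of the arc. Both enumerations have the same number
      of vertices, so \<open>E\<close> and \<open>F\<close> have equally many elements and the
      inclusion of \<open>F\<close> in \<open>E\<close> is an equality.\<close>
    define E where "E = {(p, q). p \<in> {x \<in> C. pure x} \<and> q \<in> {x \<in> C. pure x} \<and> adjP p q}"
    define F where "F = (\<lambda>i. (h i, h (Suc i))) ` {..<k} \<union> (\<lambda>i. (h (Suc i), h i)) ` {..<k}"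
    have "card {..k'} = card {..k}"
      using h' bij by (metis bij_betw_same_card path_enum_def)
    then have "card E = card F"
      using card_path_enum_pairs[OF h'] card_consecutive_pairs[of h k] bij
      by (simp add: E_def F_def h_def bij_betw_def)
    moreover have "(h i, h (Suc i)) \<in> E \<and> (h (Suc i), h i) \<in> E" if "i < k" for i
      using chainP[OF that] hC[of i] hC[of "Suc i"] that by (simp add: E_def adjP_sym[of "h (Suc i)"])
    then have "F \<subseteq> E"
      by (auto simp: F_def)
    moreover have "finite E"
    proof (rule finite_subset)
      show "E \<subseteq> C \<times> C"
        by (auto simp: E_def)
      show "finite (C \<times> C)"
        using Cg by simp
    qed
    ultimately have EF: "E = F"
      by (metis card_subset_eq)
    show "straddle_closed C"
      unfolding straddle_closed_def
    proof (intro ballI allI impI)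
      fix u v m assume "u \<in> C" "v \<in> C" and m: "straddle m u v"
      moreover have "adjP u v"
        using m unfolding adjP_def by blast
      ultimately have "(u, v) \<in> F"
        using straddle_pure[OF m] by (simp add: EF[symmetric] E_def)
      then obtain i where "i < k" "straddle m (h i) (h (Suc i)) \<or> straddle m (h (Suc i)) (h i)"
        using m by (auto simp: F_def)
      then have i: "i < k" "straddle m (h i) (h (Suc i))"
        using straddle_sym by blast+
      \<comment> \<open>Opposite points are not adjacent, so \<open>chain\<close> offers a midpoint
        in \<open>C\<close>; uniqueness of midpoints identifies it with \<open>m\<close>.\<close>
      then show "m \<in> C"
        using chain[OF i(1)] straddle_adj[OF i(2)] straddle_unique_mid[OF i(2)] by blast
    qed
  qed
  also have "\<dots> \<longleftrightarrow> Gam_star (Gam -` C) = C"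
    using Gam_star_fixed_iff arc_mixed_straddled[OF g pure_ends str] by blast
  finally show ?thesis .
qed

section \<open>Jordan curves\<close>

text \<open>If every vertex deletion leaves a path, then every degree equals the number of edges minus
  a constant, so the graph is regular; handshaking then forces the degree to be 2.\<close>

lemma vertex_deleted_paths_degree:
  assumes fin: "finite V" and card: "card V \<ge> 3"
    and sym: "\<And>p q. R p q \<longleftrightarrow> R q p" and irrefl: "\<And>p. \<not> R p p"
    and path: "\<And>v. v \<in> V \<Longrightarrow> \<exists>n g. path_enum R n g (V - {v})"
    and "v \<in> V"
  shows "card {w \<in> V. R v w} = 2"
proof -
  define N where "N v = {w \<in> V. R v w}" for v
  define E where "E = {(p, q). p \<in> V \<and> q \<in> V \<and> R p q}"
  have finN: "finite (N v)" for v
    using fin by (simp add: N_def)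
  have "E = Sigma V N"
    by (auto simp: E_def N_def)
  then have hs: "card E = (\<Sum>v\<in>V. card (N v))"
    using fin finN by simp
  \<comment> \<open>The path left by deleting \<open>v\<close> has \<open>card V - 1\<close>
    vertices and \<open>card V - 2\<close> edges; each neighbour of \<open>v\<close> contributes two
    more ordered pairs. Adding 4 on the left avoids truncated subtraction.\<close>
  have del: "card E + 4 = 2 * card V + 2 * card (N v)" if v: "v \<in> V" for v
  proof -
    obtain n g where g: "path_enum R n g (V - {v})"
      using path[OF v] by blast
    define E' where "E' = {(p, q). p \<in> V - {v} \<and> q \<in> V - {v} \<and> R p q}"
    have E': "card E' = 2 * n"
      using card_path_enum_pairs[OF g] by (simp add: E'_def)
    have "card {..n} = card (V - {v})"
      using g bij_betw_same_card unfolding path_enum_def by blast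
    then have n: "n + 2 = card V"
      using v fin card by (simp add: card_Diff_singleton)
    have "E = E' \<union> (Pair v ` N v \<union> (\<lambda>w. (w, v)) ` N v)"
      using v sym by (auto simp: E_def E'_def N_def)
    moreover have "E' \<inter> (Pair v ` N v \<union> (\<lambda>w. (w, v)) ` N v) = {}"
      by (auto simp: E'_def)
    moreover have "Pair v ` N v \<inter> (\<lambda>w. (w, v)) ` N v = {}"
      using irrefl by (auto simp: N_def)
    moreover have "finite E'"
      by (rule finite_subset[of _ "V \<times> V"]) (auto simp: E'_def fin)
    ultimately have "card E = card E' + (card (Pair v ` N v) + card ((\<lambda>w. (w, v)) ` N v))"
      using finN by (simp add: card_Un_disjoint)
    also have "\<dots> = 2 * n + 2 * card (N v)"
      by (simp add: E' card_image inj_on_def)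
    finally show ?thesis
      using n by simp
  qed
  have "card (N w) = card (N v)" if "w \<in> V" for w
    using del[OF that] del[OF \<open>v \<in> V\<close>] by simp
  then have "card E = card V * card (N v)"
    using hs by simp
  with del[OF \<open>v \<in> V\<close>] have "card V * card (N v) + 4 = 2 * card V + 2 * card (N v)"
    by simp
  \<comment> \<open>With \<open>card V = c + 2\<close> the equation becomes a multiple of
    \<open>c\<close>, which is positive and cancels.\<close>
  moreover obtain c where c: "card V = c + 2" "c > 0"
    using that[of "card V - 2"] card by simp
  ultimately have "c * card (N v) = c * 2"
    by (simp add: algebra_simps)
  then show ?thesis
    using c by (simp add: N_def)
qed

section \<open>Neighbours on a Jordan curve\<close>

text \<open>Degree two comes from the arcs left by deleting a point. For a mixed \<open>y\<close>,
  deleting a fourth point \<open>w\<close> leaves an arc in which \<open>y\<close> stands between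
  \<open>u\<close> and \<open>v\<close>.\<close>

lemma jordan_neighbours:
  assumes J: "khalimsky_jordan_curve J" and y: "y \<in> J"
  obtains u v where "u \<noteq> v" "{w \<in> J. adjK y w} = {u, v}" "mixed y \<Longrightarrow> straddle y u v"
proof -
  have card: "card J \<ge> 4" and arc: "\<And>x. x \<in> J \<Longrightarrow> khalimsky_arc (J - {x})"
    using J by (auto simp: khalimsky_jordan_curve_def)
  have fin: "finite J"
    using card card.infinite by fastforce
  have "card {w \<in> J. adjK y w} = 2"
  proof (rule vertex_deleted_paths_degree[OF fin _ adjK_sym adjK_irrefl _ y])
    show "\<exists>n g. path_enum adjK n g (J - {v})" if "v \<in> J" for v
      using khalimsky_arc_enum[OF arc[OF that]] by blast
  qed (use card in simp)
  then obtain u v where uv: "u \<noteq> v" "{w \<in> J. adjK y w} = {u, v}"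
    by (auto simp: card_2_iff)
  moreover have "straddle y u v" if m: "mixed y"
  proof -
    have "\<not> J \<subseteq> {y, u, v}"
      using card card_mono[of "{y, u, v}" J]
      by (auto simp: card_insert_if split: if_splits)
    then obtain w where w: "w \<in> J" "w \<notin> {y, u, v}"
      by blast
    obtain n g where g: "path_enum adjK n g (J - {w})" and
      str: "\<And>i. Suc (Suc i) \<le> n \<Longrightarrow> mixed (g (Suc i)) \<Longrightarrow> straddle (g (Suc i)) (g i) (g (Suc (Suc i)))"
      using khalimsky_arc_enum[OF arc[OF w(1)]] by blast
    have Jg: "J - {w} = g ` {..n}"
      using g by (auto simp: path_enum_def bij_betw_def)
    have adj: "adjK (g i) (g j) \<longleftrightarrow> i = Suc j \<or> j = Suc i" if "i \<le> n" "j \<le> n" for i j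
      using g that by (auto simp: path_enum_def)
    have "y \<in> J - {w}" "u \<in> J - {w}" "v \<in> J - {w}" "adjK y u" "adjK y v"
      using uv y w by auto
    then obtain l i j where lij: "l \<le> n" "i \<le> n" "j \<le> n" "y = g l" "u = g i" "v = g j"
      unfolding Jg by auto
    with \<open>adjK y u\<close> \<open>adjK y v\<close> uv(1) have "l = Suc i \<and> j = Suc l \<or> l = Suc j \<and> i = Suc l"
      by (auto simp: adj)
    then have "straddle y u v \<or> straddle y v u"
      using str[of i] str[of j] lij m by auto
    then show ?thesis
      using straddle_sym by blast
  qed
  ultimately show ?thesis
    using that by blast
qed

lemma jordan_mixed_straddled:
  assumes "khalimsky_jordan_curve J" "m \<in> J" "mixed m"
  shows "\<exists>u\<in>J. \<exists>v\<in>J. straddle m u v"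
proof -
  obtain u v where "{w \<in> J. adjK m w} = {u, v}" "straddle m u v"
    using jordan_neighbours[OF assms(1,2)] assms(3) by metis
  moreover from this have "u \<in> J" "v \<in> J"
    by auto
  ultimately show ?thesis
    by blast
qed

lemma jordan_mixed_opposite:
  assumes "khalimsky_jordan_curve J" "m \<in> J" "mixed m" "y \<in> J" "z \<in> J" "adjK m y" "adjK m z" "y \<noteq> z"
  shows "straddle m y z"
proof -
  obtain u v where "{w \<in> J. adjK m w} = {u, v}" "straddle m u v"
    using jordan_neighbours[OF assms(1,2)] assms(3) by metis
  moreover have "{y, z} \<subseteq> {w \<in> J. adjK m w}"
    using assms by simp
  ultimately have "y = u \<and> z = v \<or> y = v \<and> z = u"
    using assms(8) by auto
  then show ?thesis
    using \<open>straddle m u v\<close> straddle_sym by blast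
qed

text \<open>The step from \<open>y\<close> to \<open>u\<close> along the curve ends at \<open>z = u\<close>, or passes over \<open>u\<close> if \<open>u\<close> is mixed.\<close>

definition leads :: "int \<times> int \<Rightarrow> int \<times> int \<Rightarrow> int \<times> int \<Rightarrow> bool" where
  "leads y u z \<longleftrightarrow> pure u \<and> adjK y u \<and> z = u \<or> straddle u y z"

lemma adjP_iff_leads: "pure z \<Longrightarrow> adjP y z \<longleftrightarrow> (\<exists>u. leads y u z)"
  unfolding adjP_def leads_def by blast

lemma leads_adjK: "leads y u z \<Longrightarrow> adjK y u"
  using straddle_adj adjK_sym unfolding leads_def by blast

lemma leads_unique: "leads y u z \<Longrightarrow> leads y u z' \<Longrightarrow> z = z'"
  using straddle_pure straddle_unique_end unfolding leads_def by blast

text \<open>The two ways of leading to \<open>z\<close> exclude each other, since opposite points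
  are not adjacent, and a midpoint is unique.\<close>

lemma leads_unique_mid: "leads y u z \<Longrightarrow> leads y u' z \<Longrightarrow> u = u'"
  using straddle_adj straddle_unique_mid unfolding leads_def by blast

text \<open>A mixed \<open>u\<close> has a second neighbour on the curve, and it lies opposite to
  \<open>y\<close>.\<close>

lemma jordan_leads:
  assumes J: "khalimsky_jordan_curve J" and y: "y \<in> J" "pure y" and u: "u \<in> J" "adjK y u"
  shows "\<exists>z\<in>J. pure z \<and> leads y u z"
proof (cases "pure u")
  case True
  then show ?thesis
    using u by (auto simp: leads_def)
next
  case False
  obtain a b where ab: "a \<noteq> b" "{w \<in> J. adjK u w} = {a, b}"
    using jordan_neighbours[OF J u(1)] by metis
  then have "a \<in> J" "b \<in> J" "adjK u a" "adjK u b"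
    by auto
  then obtain z where "z \<in> J" "adjK u z" "z \<noteq> y"
    using ab(1) by metis
  then have "straddle u y z"
    using jordan_mixed_opposite[OF J u(1) False y(1)] u(2) adjK_sym by metis
  then show ?thesis
    using \<open>z \<in> J\<close> straddle_pure unfolding leads_def by blast
qed

text \<open>The two curve neighbours of a pure \<open>y\<close> lead to distinct pure points
  \<open>a\<close> and \<open>b\<close>. A further 8-neighbour on \<open>J\<close> could only be
  reached through a midpoint outside \<open>J\<close>.\<close>

lemma jordan_degree:
  assumes J: "khalimsky_jordan_curve J"
  shows "(\<forall>y\<in>{x \<in> J. pure x}. card {z \<in> {x \<in> J. pure x}. adjP y z} = 2) \<longleftrightarrow> straddle_closed J"
proof -
  have fin: "finite J"
    using J card.infinite by (fastforce simp: khalimsky_jordan_curve_def)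
  have ex: "\<exists>a b. a \<noteq> b \<and> {a, b} \<subseteq> {z \<in> J. pure z \<and> adjP y z} \<and>
      (\<forall>z u. u \<in> J \<longrightarrow> leads y u z \<longrightarrow> z \<in> {a, b}) \<and> (\<exists>u\<in>J. leads y u a) \<and> (\<exists>u\<in>J. leads y u b)"
    if y: "y \<in> J" "pure y" for y
  proof -
    obtain u v where uv: "u \<noteq> v" "{w \<in> J. adjK y w} = {u, v}"
      using jordan_neighbours[OF J y(1)] by metis
    then have mem: "u \<in> J" "v \<in> J" "adjK y u" "adjK y v"
      by auto
    obtain a where a: "a \<in> J" "pure a" "leads y u a"
      using jordan_leads[OF J y mem(1,3)] by blast
    obtain b where b: "b \<in> J" "pure b" "leads y v b"
      using jordan_leads[OF J y mem(2,4)] by blast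
    have "a \<noteq> b"
      using a b uv(1) leads_unique_mid by blast
    moreover have "z \<in> {a, b}" if "w \<in> J" "leads y w z" for w z
    proof -
      have "w \<in> {u, v}"
        using that leads_adjK uv(2) by blast
      then show ?thesis
        using that(2) a(3) b(3) leads_unique by blast
    qed
    moreover have "{a, b} \<subseteq> {z \<in> J. pure z \<and> adjP y z}"
      using a b adjP_iff_leads by blast
    ultimately show ?thesis
      using a(3) b(3) mem by blast
  qed
  show ?thesis
  proof
    assume deg: "\<forall>y\<in>{x \<in> J. pure x}. card {z \<in> {x \<in> J. pure x}. adjP y z} = 2"
    show "straddle_closed J"
      unfolding straddle_closed_def
    proof (intro ballI allI impI)
      fix y z m assume y: "y \<in> J" and z: "z \<in> J" and m: "straddle m y z"
      then have p: "pure y" "pure z"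
        using straddle_pure by auto
      obtain a b where ab: "a \<noteq> b" "{a, b} \<subseteq> {z \<in> J. pure z \<and> adjP y z}"
        "\<exists>u\<in>J. leads y u a" "\<exists>u\<in>J. leads y u b"
        using ex[OF y p(1)] by blast
      have "card {z \<in> {x \<in> J. pure x}. adjP y z} = 2"
        using deg y p by blast
      then have "card {z \<in> J. pure z \<and> adjP y z} = card {a, b}"
        using ab(1) by simp
      then have "{z \<in> J. pure z \<and> adjP y z} = {a, b}"
        using card_subset_eq[OF _ ab(2)] fin by simp
      moreover have "leads y m z"
        using m by (simp add: leads_def)
      then have "z \<in> {z \<in> J. pure z \<and> adjP y z}"
        using z p adjP_iff_leads by blast
      ultimately have "z = a \<or> z = b"
        by blast
      \<comment> \<open>Both \<open>a\<close> and \<open>b\<close> are reached through points of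
        \<open>J\<close>; as \<open>y\<close> and \<open>z\<close> determine the intermediate point,
        it is \<open>m\<close>.\<close>
      then obtain u where "u \<in> J" "leads y u z"
        using ab(3,4) by metis
      then show "m \<in> J"
        using leads_unique_mid \<open>leads y m z\<close> by blast
    qed
  next
    assume closed: "straddle_closed J"
    show "\<forall>y\<in>{x \<in> J. pure x}. card {z \<in> {x \<in> J. pure x}. adjP y z} = 2"
    proof
      fix y assume "y \<in> {x \<in> J. pure x}"
      then have y: "y \<in> J" "pure y"
        by auto
      obtain a b where ab: "a \<noteq> b" "{a, b} \<subseteq> {z \<in> J. pure z \<and> adjP y z}"
        "\<forall>z u. u \<in> J \<longrightarrow> leads y u z \<longrightarrow> z \<in> {a, b}"
        using ex[OF y] by blast
      have "z \<in> {a, b}" if z: "z \<in> J" "pure z" "adjP y z" for z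
      proof -
        obtain u where u: "leads y u z"
          using z adjP_iff_leads by blast
        then have "u \<in> J"
          using closed y z unfolding leads_def straddle_closed_def by blast
        then show ?thesis
          using ab(3) u by blast
      qed
      then have "{z \<in> {x \<in> J. pure x}. adjP y z} = {a, b}"
        using ab(2) by blast
      then show "card {z \<in> {x \<in> J. pure x}. adjP y z} = 2"
        using ab(1) by simp
    qed
  qed
qed

section \<open>Connectedness of the pure points\<close>

text \<open>A separation of the pure points would extend to an open separation of \<open>J\<close>:
  \<open>H\<close> assigns mixed points to the side of their neighbours, and \<open>U\<close> is the
  open hull of a side.\<close>

lemma jordan_no_separation:
  assumes J: "khalimsky_jordan_curve J"
    and PQ: "P \<union> Q = {x \<in> J. pure x}" "P \<inter> Q = {}" "P \<noteq> {}" "Q \<noteq> {}"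
    and sep: "\<forall>p\<in>P. \<forall>q\<in>Q. \<not> adjP p q"
  shows False
proof -
  define H where "H X = X \<union> {m \<in> J. mixed m \<and> (\<exists>p\<in>X. adjK m p)}" for X
  define U where "U X = \<Union> (min_nbhd ` H X)" for X
  have "openin khalimsky2 (U X)" for X
    unfolding U_def using openin_min_nbhd by blast
  \<comment> \<open>So \<open>U X\<close> meets \<open>J\<close> only in \<open>H X\<close>. The
    crucial case is a mixed \<open>x\<close>: its curve neighbours are opposite, hence 8-adjacent,
    hence on one side.\<close>
  have grow: "w \<in> H X"
    if X: "X \<union> Y = {x \<in> J. pure x}" "\<forall>p\<in>X. \<forall>q\<in>Y. \<not> adjP p q"
      and x: "x \<in> H X" and w: "w \<in> J" "w \<in> min_nbhd x" for X Y x w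
  proof (cases "w = x")
    case False
    then have xw: "adjK x w" "adjK w x"
      using w(2) by (auto simp: adjK_def)
    show ?thesis
    proof (cases "pure x")
      case True
      then have "x \<in> X"
        using x by (simp add: H_def)
      then show ?thesis
        using X w(1) xw by (cases "pure w") (auto simp: H_def adjP_def)
    next
      case False
      then obtain p where p: "x \<in> J" "p \<in> X" "adjK x p"
        using x X by (auto simp: H_def)
      then have "p \<in> J"
        using X by auto
      have "pure w"
        using False xw by (auto simp: adjK_diff)
      have "p = w \<or> straddle x p w"
        using jordan_mixed_opposite[OF J p(1) False \<open>p \<in> J\<close> w(1) p(3) xw(1)] by blast
      then have "p = w \<or> adjP p w"
        unfolding adjP_def by blast
      then have "w \<in> X"
        using X p \<open>pure w\<close> w(1) by blast
      then show ?thesis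
        by (simp add: H_def)
    qed
  qed (use x in simp)
  have sep': "\<forall>p\<in>Q. \<forall>q\<in>P. \<not> adjP p q" and QP: "Q \<union> P = {x \<in> J. pure x}"
    using sep PQ adjP_sym by blast+
  have "J \<subseteq> H P \<union> H Q"
  proof
    fix x assume x: "x \<in> J"
    show "x \<in> H P \<union> H Q"
    proof (cases "pure x")
      case True
      then show ?thesis using x PQ(1) by (auto simp: H_def)
    next
      case False
      then obtain u v where "u \<in> J" "straddle x u v"
        using jordan_mixed_straddled[OF J x] by blast
      then have "u \<in> P \<union> Q" "adjK x u"
        using PQ(1) straddle_pure straddle_adj by auto
      then show ?thesis
        using x False by (auto simp: H_def)
    qed
  qed
  moreover have "H X \<subseteq> U X" for X
    by (auto simp: U_def)
  ultimately have cover: "J \<subseteq> U P \<union> U Q"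
    by blast
  have "w \<notin> U P \<or> w \<notin> U Q" if w: "w \<in> J" for w
  proof (rule ccontr)
    assume "\<not> ?thesis"
    then obtain x y where "x \<in> H P" "w \<in> min_nbhd x" "y \<in> H Q" "w \<in> min_nbhd y"
      unfolding U_def by blast
    then have h: "w \<in> H P" "w \<in> H Q"
      using grow[OF PQ(1) sep] grow[OF QP sep'] w by blast+
    show False
    proof (cases "pure w")
      case True
      then show ?thesis
        using h PQ(2) by (auto simp: H_def)
    next
      case False
      \<comment> \<open>Neighbours of \<open>w\<close> on different sides would be an opposite pair,
        thus 8-adjacent across the separation.\<close>
      then obtain p q where pq: "p \<in> P" "q \<in> Q" "adjK w p" "adjK w q"
        using h PQ(1) by (auto simp: H_def)
      then have "straddle w p q"
        using jordan_mixed_opposite[OF J w False] PQ(1,2) by blast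
      then show ?thesis
        using sep pq unfolding adjP_def by blast
    qed
  qed
  then have "U P \<inter> U Q \<inter> J = {}"
    by blast
  moreover have "U P \<inter> J \<noteq> {}" "U Q \<inter> J \<noteq> {}"
    using PQ \<open>H P \<subseteq> U P\<close> \<open>H Q \<subseteq> U Q\<close> unfolding H_def by blast+
  moreover have "connectedin khalimsky2 J"
    using J by (simp add: khalimsky_jordan_curve_def)
  ultimately show False
    using cover connectedinD \<open>openin khalimsky2 (U P)\<close> \<open>openin khalimsky2 (U Q)\<close> by meson
qed

section \<open>At least four pure points\<close>

text \<open>Adjacent pure points differ by a diagonal step, which exchanges even-even and odd-odd
  points.\<close>

lemma adjK_pure_parity:
  assumes "pure a" "pure b" "adjK a b"
  shows "even (fst a) \<longleftrightarrow> odd (fst b)"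
proof -
  obtain i j k l where ab: "a = (i, j)" "b = (k, l)"
    by (cases a; cases b)
  then have h: "even i = even j" "even k = even l" "i \<noteq> k \<or> j \<noteq> l" "\<bar>i - k\<bar> \<le> 1" "\<bar>j - l\<bar> \<le> 1"
    using assms by (simp_all add: pure_iff adjK_diff)
  have "i \<noteq> k"
  proof
    assume "i = k"
    with h have "j = l + 1 \<or> l = j + 1"
      by auto
    with h(1,2) \<open>i = k\<close> show False
      by auto
  qed
  with h(4) have "i = k + 1 \<or> k = i + 1"
    by auto
  then show ?thesis
    by (auto simp: ab)
qed

lemma straddle_parity:
  "straddle m a b \<Longrightarrow> even (fst a) \<longleftrightarrow> even (fst b)"
  by (auto simp: straddle_def)

text \<open>Used against triangles: the midpoint of one edge would gain a third neighbour. The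
  parity of \<open>c\<close> decides whether it is joined to \<open>a\<close> and \<open>b\<close>
  by opposite pairs or by adjacency.\<close>

lemma straddle_third:
  assumes m: "straddle m a b" and ca: "adjP c a" and cb: "adjP c b" and "pure c"
  shows "adjK m c"
proof -
  have p: "mixed m" "pure a" "pure b"
    using straddle_pure[OF m] by auto
  have par: "even (fst a) \<longleftrightarrow> even (fst b)"
    by (rule straddle_parity[OF m])
  obtain d where d: "d \<in> {(1, 0), (-1, 0), (0, 1), (0, -1)}" "a = m + d" "b = m - d"
    using m unfolding straddle_def by blast
  show ?thesis
  proof (cases "even (fst c) \<longleftrightarrow> even (fst a)")
    case True
    then obtain m1 m2 where "straddle m1 c a" "straddle m2 c b"
      using ca cb par adjK_pure_parity p \<open>pure c\<close> unfolding adjP_def by blast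
    then obtain e f where e: "e \<in> {(1, 0), (-1, 0), (0, 1), (0, -1)}" "c = m1 + e" "a = m1 - e"
      and f: "f \<in> {(1, 0), (-1, 0), (0, 1), (0, -1)}" "c = m2 + f" "b = m2 - f"
      unfolding straddle_def by blast
    have "fst a = fst m + fst d" "fst b = fst m - fst d" "fst c = fst m1 + fst e"
      "fst a = fst m1 - fst e" "fst c = fst m2 + fst f" "fst b = fst m2 - fst f"
      "snd a = snd m + snd d" "snd b = snd m - snd d" "snd c = snd m1 + snd e"
      "snd a = snd m1 - snd e" "snd c = snd m2 + snd f" "snd b = snd m2 - snd f"
      using d(2,3) e(2,3) f(2,3) by (metis fst_add fst_diff snd_add snd_diff)+
    \<comment> \<open>Impossible: \<open>d\<close>, \<open>e\<close> and \<open>f\<close> are unit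
      axis vectors, whose coordinate sums are odd.\<close>
    then have "fst d = fst f - fst e" "snd d = snd f - snd e"
      by linarith+
    then show ?thesis
      using d(1) e(1) f(1) by auto
  next
    case False
    then have "adjK c a" "adjK c b"
      using ca cb par straddle_parity unfolding adjP_def by metis+
    then have le: "\<bar>fst c - fst a\<bar> \<le> 1" "\<bar>fst c - fst b\<bar> \<le> 1"
      "\<bar>snd c - snd a\<bar> \<le> 1" "\<bar>snd c - snd b\<bar> \<le> 1"
      by (simp_all add: adjK_diff)
    have "(fst c = fst m \<and> \<bar>snd c - snd m\<bar> \<le> 1) \<or> (snd c = snd m \<and> \<bar>fst c - fst m\<bar> \<le> 1)"
    proof -
      have le': "\<bar>fst c - (fst m + fst d)\<bar> \<le> 1" "\<bar>fst c - (fst m - fst d)\<bar> \<le> 1"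
        "\<bar>snd c - (snd m + snd d)\<bar> \<le> 1" "\<bar>snd c - (snd m - snd d)\<bar> \<le> 1"
        using le by (simp_all add: d(2,3))
      \<comment> \<open>Along the axis of \<open>d\<close> the points \<open>a\<close> and
        \<open>b\<close> are two apart, so \<open>c\<close> must share that coordinate with
        \<open>m\<close>.\<close>
      consider "snd d = 0" "\<bar>fst d\<bar> = 1" | "fst d = 0" "\<bar>snd d\<bar> = 1"
        using d(1) by auto
      then show ?thesis
      proof cases
        case 1
        then have "fst c = fst m"
          using le'(1,2) by linarith
        then show ?thesis using le'(3) 1 by simp
      next
        case 2
        then have "snd c = snd m"
          using le'(3,4) by linarith
        then show ?thesis using le'(1) 2 by simp
      qed
    qed
    moreover have "c \<noteq> m"
      using p(1) \<open>pure c\<close> by auto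
    ultimately show ?thesis
      using p(1) \<open>pure c\<close> unfolding adjK_diff by auto
  qed
qed

text \<open>With fewer than four pure points, degree two forces a triangle. Its edges cannot all
  change parity, so one is an opposite pair; its midpoint lies on \<open>J\<close> and is adjacent
  to all three points, against its two neighbours.\<close>

lemma jordan_card_pure:
  assumes J: "khalimsky_jordan_curve J" and closed: "straddle_closed J"
  shows "card {x \<in> J. pure x} \<ge> 4"
proof (rule ccontr)
  assume small: "\<not> ?thesis"
  define B where "B = {x \<in> J. pure x}"
  have card: "card J \<ge> 4"
    using J by (simp add: khalimsky_jordan_curve_def)
  then have fin: "finite B"
    using card.infinite by (fastforce simp: B_def)
  have deg: "card {z \<in> B. adjP y z} = 2" if "y \<in> B" for y
    using jordan_degree[OF J] closed that unfolding B_def by blast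
  have "J \<noteq> {}"
    using card by auto
  then obtain x where "x \<in> J" by blast
  then obtain y where y: "y \<in> B"
    using jordan_mixed_straddled[OF J] straddle_pure unfolding B_def by blast
  then have "card {z \<in> B. adjP y z} = 2"
    by (rule deg)
  then obtain a b where ab: "a \<noteq> b" "{z \<in> B. adjP y z} = {a, b}"
    unfolding card_2_iff by blast
  then have mem: "a \<in> B" "b \<in> B" "adjP y a" "adjP y b"
    by auto
  then have ne: "a \<noteq> y" "b \<noteq> y"
    by auto
  have "card {y, a, b} = 3"
    using ne ab(1) by auto
  then have Beq: "B = {y, a, b}"
    using small fin y mem card_seteq[of B "{y, a, b}"] by (auto simp: B_def)
  have "{z \<in> B. adjP a z} \<subseteq> {y, b}"
    using Beq by auto
  moreover have "card {y, b} = 2"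
    using ne by simp
  ultimately have "{z \<in> B. adjP a z} = {y, b}"
    using deg[OF mem(1)] by (metis card_subset_eq finite.emptyI finite_insert)
  then have "adjP a b"
    by auto
  then have adj: "adjP y a" "adjP y b" "adjP a b" "adjP a y" "adjP b y" "adjP b a"
    using mem adjP_sym by auto
  have p: "pure y" "pure a" "pure b" and J3: "y \<in> J" "a \<in> J" "b \<in> J"
    using y mem by (auto simp: B_def)
  have "\<exists>m. straddle m y a \<or> straddle m y b \<or> straddle m a b"
    using adj adjK_pure_parity p unfolding adjP_def by blast
  then obtain m where m: "adjK m y" "adjK m a" "adjK m b" "m \<in> J"
    using straddle_third[of _ y a b] straddle_third[of _ y b a] straddle_third[of _ a b y]
      adj p straddle_adj closed J3 unfolding straddle_closed_def by metis
  obtain u v where "{w \<in> J. adjK m w} = {u, v}"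
    using jordan_neighbours[OF J m(4)] by metis
  then have "{y, a, b} \<subseteq> {u, v}"
    using m J3 by auto
  then show False
    using ne ab(1) by auto
qed

section \<open>Closed 8-curves from Jordan curves\<close>

text \<open>Finiteness and connectedness come from \<open>J\<close> being a Jordan curve. The degree
  condition is equivalent to \<open>straddle_closed\<close>, which also yields the four
  points.\<close>

lemma jordan_closed_curve8_iff:
  assumes J: "khalimsky_jordan_curve J"
  shows "closed_curve8 (Gam -` J) \<longleftrightarrow> Gam_star (Gam -` J) = J"
proof -
  define B where "B = {x \<in> J. pure x}"
  have bij: "bij_betw Gam (Gam -` J) B"
    using Gam_image_vimage by (simp add: B_def bij_betw_def inj_on_def del: image_vimage_eq)
  have deg: "card {q \<in> Gam -` J. adj8 p q} = card {z \<in> B. adjP (Gam p) z}" for p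
  proof -
    have "bij_betw Gam {q \<in> Gam -` J. adj8 p q} {z \<in> B. adjP (Gam p) z}"
      using bij by (auto simp: bij_betw_def inj_on_def adj8_adjP)
    then show ?thesis
      by (rule bij_betw_same_card)
  qed
  have "(\<forall>p\<in>Gam -` J. card {q \<in> Gam -` J. adj8 p q} = 2) \<longleftrightarrow>
      (\<forall>y\<in>B. card {z \<in> B. adjP y z} = 2)"
  proof -
    have "Gam ` (Gam -` J) = B"
      using bij by (simp only: bij_betw_def)
    then have "(\<forall>p\<in>Gam -` J. R (Gam p)) \<longleftrightarrow> (\<forall>y\<in>B. R y)" for R
      by blast
    then show ?thesis
      unfolding deg .
  qed
  also have "\<dots> \<longleftrightarrow> straddle_closed J"
    unfolding B_def by (rule jordan_degree[OF J])
  finally have deg_iff: "(\<forall>p\<in>Gam -` J. card {q \<in> Gam -` J. adj8 p q} = 2) \<longleftrightarrow> straddle_closed J" .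
  have "finite J"
    using J card.infinite by (fastforce simp: khalimsky_jordan_curve_def)
  then have "finite (Gam -` J)"
    by (simp add: finite_vimageI inj_def)
  moreover have "card (Gam -` J) \<ge> 4" if "straddle_closed J"
    using jordan_card_pure[OF J that] bij_betw_same_card[OF bij] by (simp add: B_def)
  moreover have "connected8 (Gam -` J)"
    unfolding connected8_def
  proof clarify
    fix P Q assume PQ: "P \<union> Q = Gam -` J" "P \<inter> Q = {}" "P \<noteq> {}" "Q \<noteq> {}"
      and sep: "\<forall>p\<in>P. \<forall>q\<in>Q. \<not> adj8 p q"
    have "Gam ` P \<union> Gam ` Q = {x \<in> J. pure x}"
      using PQ(1) by (metis Gam_image_vimage image_Un)
    moreover have "Gam ` P \<inter> Gam ` Q = {}"
      using PQ(2) by auto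
    moreover have "\<forall>p\<in>Gam ` P. \<forall>q\<in>Gam ` Q. \<not> adjP p q"
      using sep unfolding adj8_adjP by blast
    ultimately show False
      using jordan_no_separation[OF J, of "Gam ` P" "Gam ` Q"] PQ(3,4) by blast
  qed
  ultimately have "closed_curve8 (Gam -` J) \<longleftrightarrow> straddle_closed J"
    using deg_iff unfolding closed_curve8_def by blast
  also have "\<dots> \<longleftrightarrow> Gam_star (Gam -` J) = J"
    using Gam_star_fixed_iff jordan_mixed_straddled[OF J] by blast
  finally show ?thesis .
qed

theorem theorem4p10:
  "(\<forall>C. khalimsky_arc C \<and> (\<forall>x\<in>arc_endpoints C. pure x) \<longrightarrow>
        (path8 (Gam -` C) \<longleftrightarrow> Gam_star (Gam -` C) = C)) \<and>
   (\<forall>J. khalimsky_jordan_curve J \<longrightarrow>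
        (closed_curve8 (Gam -` J) \<longleftrightarrow> Gam_star (Gam -` J) = J))"
  using arc_path8_iff jordan_closed_curve8_iff by blast

end
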